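(* For each integer $k\ge 7$, there exist trees of arbitrarily large order in which the maximum number of pairwise disjoint $P_k$-isolating sets is at most $\frac{3k+10}{4}$, where $\frac{3k+10}{4} < k+1$.
   Context: Graphs are finite and simple; the order of a graph is its number of vertices. $P_k$ denotes the path on $k$ vertices. For a graph $G$ and $S\subseteq V(G)$, $N[S]$ denotes $S$ together with all vertices adjacent to a vertex of $S$. A set $S\subseteq V(G)$ is $P_k$-isolating if $G-N[S]$ contains no (not necessarily induced) subgraph isomorphic to $P_k$. *)

theory Defs
  imports Complex_Main "Graph_Theory.Graph_Theory"
begin

text \<open>
  Undirected simple graphs are the symmetric, loop-free, finite digraphs without parallel arcs,
  that is, \<^const>\<open>graph\<close>; an edge \<open>uv\<close> is the pair of arcs from \<open>u\<close> to \<open>v\<close> and from \<open>v\<close> to \<open>u\<close>.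
\<close>

text \<open>
  The library predicate \<^const>\<open>tree\<close> is not usable here: \<^const>\<open>forest\<close> forbids every directed
  cycle, including the closed walk \<open>u, v, u\<close> along a single undirected edge. In a symmetric digraph
  without parallel arcs, the undirected cycles are the directed cycles of length at least 3.
\<close>

definition undirected_tree :: "('a, 'b) pre_digraph \<Rightarrow> bool" where
  "undirected_tree G \<longleftrightarrow>
     graph G \<and> connected G \<and> \<not> (\<exists>p. pre_digraph.cycle G p \<and> length p \<ge> 3)"

definition path_graph :: "nat \<Rightarrow> nat pair_pre_digraph" where
  "path_graph k =
     \<lparr>pverts = {..<k}, parcs = {(i, j). i < k \<and> j < k \<and> (j = Suc i \<or> i = Suc j)}\<rparr>"

definition closed_nbhd :: "('a, 'b) pre_digraph \<Rightarrow> 'a set \<Rightarrow> 'a set" where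
  "closed_nbhd G S = S \<union> {v. \<exists>u\<in>S. u \<rightarrow>\<^bsub>G\<^esub> v}"

definition contains_path :: "nat \<Rightarrow> ('a, 'b) pre_digraph \<Rightarrow> bool" where
  "contains_path k G \<longleftrightarrow> (\<exists>H. subgraph H G \<and> digraph_iso (with_proj (path_graph k)) H)"

definition path_isolating :: "nat \<Rightarrow> ('a, 'b) pre_digraph \<Rightarrow> 'a set \<Rightarrow> bool" where
  "path_isolating k G S \<longleftrightarrow>
     S \<subseteq> verts G \<and> \<not> contains_path k (G \<restriction> (verts G - closed_nbhd G S))"

definition disjoint_isolating_families :: "nat \<Rightarrow> ('a, 'b) pre_digraph \<Rightarrow> 'a set set set" where
  "disjoint_isolating_families k G =
     {F. (\<forall>S\<in>F. path_isolating k G S) \<and> pairwise disjnt F}"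

definition max_disjoint_isolating :: "nat \<Rightarrow> ('a, 'b) pre_digraph \<Rightarrow> nat" where
  "max_disjoint_isolating k G = Max (card ` disjoint_isolating_families k G)"

text \<open>For a finite graph the maximum is taken over a finite nonempty set of numbers.\<close>

lemma finite_disjoint_isolating_families:
  assumes "finite (verts G)"
  shows "finite (disjoint_isolating_families k G)"
proof (rule finite_subset)
  show "disjoint_isolating_families k G \<subseteq> Pow (Pow (verts G))"
    by (auto simp: disjoint_isolating_families_def path_isolating_def)
qed (use assms in simp)

lemma empty_in_disjoint_isolating_families: "{} \<in> disjoint_isolating_families k G"
  by (simp add: disjoint_isolating_families_def)

lemma pair_graph_path_graph: "pair_graph (path_graph k)"
proof
  show "finite (parcs (path_graph k))"
    by (rule finite_subset[of _ "{..<k} \<times> {..<k}"]) (auto simp: path_graph_def)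
qed (auto simp: path_graph_def symmetric_def sym_def)

end

theory Submission
  imports Defs
begin

text \<open>
  The trees are spiders with three legs at a centre \<open>c\<close>: legs of length \<open>b\<close> and \<open>a\<close>, and a third
  leg as long as desired, where \<open>a = k div 2\<close> and \<open>b = k - 1 - a \<le> a\<close>. Let \<open>L\<close> be the first
  \<open>a\<close> vertices of the long leg. Any two of the pieces \<open>b\<close>-leg, \<open>a\<close>-leg, \<open>L\<close> form together with
  \<open>c\<close> a path on at least \<open>k\<close> vertices, so a \<open>P\<^sub>k\<close>-isolating set has to dominate a vertex of each
  of these three paths.

  The centre and its three neighbours can do this alone, but no other vertex can: a vertex at
  distance at least 2 from \<open>c\<close> dominates only vertices of its own leg, and the path through the
  other two legs survives. Moreover only \<open>c\<close>, the two bounded legs, \<open>L\<close> and the next vertex \<open>x\<close> of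
  the long leg dominate anything on the three paths. Give weight 2 to \<open>c\<close> and its neighbours,
  weight 1 to every other vertex of this list, and weight 0 to the rest of the long leg. Every
  isolating set then has weight at least 2 (\<open>spider_isolating_weight\<close>), while the total weight is
  at most \<open>(b + 2 * a + 2) + 4 = k + a + 5\<close>. Disjoint sets share no weight, so there are at most
  \<open>(k + a + 5) / 2 \<le> (3 * k + 10) / 4\<close> of them
  (\<open>card_disjoint_family_le_weight\<close>, \<open>max_disjoint_isolating_spider_le\<close>).
  The length of the long leg does not enter this bound, which makes the order arbitrary.
\<close>

section \<open>Trees given by a parent function\<close>

text \<open>
  Joining each vertex to a smaller one yields a tree. The comparison of \<open>i\<close> and \<open>j\<close> in the arc
  condition discards the value of the parent function at the root 0.
\<close>

definition parent_graph :: "(nat \<Rightarrow> nat) \<Rightarrow> nat \<Rightarrow> nat pair_pre_digraph" where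
  "parent_graph par n =
     \<lparr>pverts = {..<n},
      parcs = {(i, j). i < n \<and> j < n \<and> (i < j \<and> i = par j \<or> j < i \<and> j = par i)}\<rparr>"

lemma pverts_parent_graph [simp]: "pverts (parent_graph par n) = {..<n}"
  by (simp add: parent_graph_def)

lemma parcs_parent_graph_iff:
  "(i, j) \<in> parcs (parent_graph par n) \<longleftrightarrow>
     i < n \<and> j < n \<and> (i < j \<and> i = par j \<or> j < i \<and> j = par i)"
  by (simp add: parent_graph_def)

lemma pair_graph_parent_graph: "pair_graph (parent_graph par n)"
proof
  show "finite (parcs (parent_graph par n))"
    by (rule finite_subset[of _ "{..<n} \<times> {..<n}"]) (auto simp: parent_graph_def)
qed (auto simp: parent_graph_def symmetric_def sym_def)

lemma parent_graph_adjacent_below: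
  assumes "(i, m) \<in> parcs (parent_graph par n) \<or> (m, i) \<in> parcs (parent_graph par n)"
    and "i \<le> m"
  shows "i = par m"
  using assms by (auto simp: parcs_parent_graph_iff)

text \<open>
  A cycle is given as a list of arcs; indexing its vertices is what makes the two cyclic
  neighbours of a maximal vertex accessible.
\<close>

lemma walk_arc_nth:
  assumes "pcas u p w" "i < length p"
  shows "(pawalk_verts u p ! i, pawalk_verts u p ! Suc i) = p ! i"
  using assms
proof (induction p arbitrary: u i)
  case (Cons e p)
  show ?case
  proof (cases i)
    case 0
    then show ?thesis using Cons.prems by (cases p) (auto simp: prod_eq_iff)
  next
    case (Suc j)
    then show ?thesis using Cons by auto
  qed
qed simp

lemma walk_nth_ends:
  assumes "pcas u p w"
  shows "pawalk_verts u p ! 0 = u" "pawalk_verts u p ! length p = w"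
proof -
  show "pawalk_verts u p ! 0 = u"
    using assms by (cases p) auto
  show "pawalk_verts u p ! length p = w"
    using assms by (induction p arbitrary: u) auto
qed

lemma length_pawalk_verts: "length (pawalk_verts u p) = Suc (length p)"
  by (induction p arbitrary: u) auto

text \<open>
  On a cycle, both neighbours of the largest vertex lie below it, so both are its parent; a cycle
  of length at least 3 would thus repeat a vertex.
\<close>

lemma parent_graph_no_long_cycle:
  assumes cyc: "pre_digraph.cycle (with_proj (parent_graph par n)) p"
  shows "length p < 3"
proof (rule ccontr)
  assume "\<not> length p < 3"
  then have len: "length p \<ge> 3" and ne: "p \<noteq> []" by auto
  let ?E = "parcs (parent_graph par n)"
  obtain u where p: "pcas u p u" "set p \<subseteq> ?E" and dist: "distinct (tl (pawalk_verts u p))"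
    using cyc
    by (auto simp: pre_digraph.cycle_def pre_digraph.awalk_def cas_with_proj_eq
        awalk_verts_with_proj_eq)
  define v where "v i = pawalk_verts u p ! i" for i
  have arc: "(v i, v (Suc i)) \<in> ?E" if "i < length p" for i
    using walk_arc_nth[OF p(1) that] p(2) that by (auto simp: v_def)
  have closed: "v 0 = v (length p)"
    using walk_nth_ends[OF p(1)] by (simp add: v_def)
  \<comment> \<open>The start vertex appears twice, at 0 and at the last index, hence the range from 1.\<close>
  have inj: "inj_on v {1..length p}"
  proof (rule inj_onI)
    fix i j assume ij: "i \<in> {1..length p}" "j \<in> {1..length p}" "v i = v j"
    have "tl (pawalk_verts u p) ! (l - 1) = v l" if "l \<in> {1..length p}" for l
      using that by (cases l) (simp_all add: v_def nth_tl length_pawalk_verts)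
    then have "i - 1 = j - 1"
      using dist ij nth_eq_iff_index_eq[OF dist, of "i - 1" "j - 1"]
      by (auto simp: length_pawalk_verts)
    then show "i = j" using ij by auto
  qed
  obtain m where m: "m \<in> {1..length p}" and max: "\<And>i. i \<in> {1..length p} \<Longrightarrow> v i \<le> v m"
  proof -
    have "Max (v ` {1..length p}) \<in> v ` {1..length p}"
      using len by (intro Max_in) auto
    then obtain m where "m \<in> {1..length p}" "v m = Max (v ` {1..length p})" by auto
    then show thesis using that by simp
  qed
  define before where "before = (if m = 1 then length p else m - 1)"
  define after where "after = (if m = length p then 1 else m + 1)"
  have "before \<in> {1..length p}" "after \<in> {1..length p}" "before \<noteq> after"
    using m len by (auto simp: before_def after_def)
  moreover have "(v before, v m) \<in> ?E"
    using arc[of "m - 1"] m ne closed by (auto simp: before_def)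
  moreover have "(v m, v after) \<in> ?E"
    using arc[of m] arc[of 0] m ne closed by (auto simp: after_def)
  ultimately have "v before = par (v m)" "v after = par (v m)"
    using max by (blast intro: parent_graph_adjacent_below)+
  then show False
    using inj \<open>before \<in> _\<close> \<open>after \<in> _\<close> \<open>before \<noteq> after\<close> by (metis inj_onD)
qed

lemma connected_parent_graph:
  assumes "n > 0" and par: "\<And>j. 0 < j \<Longrightarrow> j < n \<Longrightarrow> par j < j"
  shows "connected (with_proj (parent_graph par n))"
proof -
  interpret pair_graph "parent_graph par n" by (rule pair_graph_parent_graph)
  have sym: "mk_symmetric (with_proj (parent_graph par n)) = parent_graph par n"
    by (auto simp: mk_symmetric_def parent_graph_def)
  \<comment> \<open>Following parents leads from every vertex down to 0.\<close>
  have root: "j \<rightarrow>\<^sup>*\<^bsub>with_proj (parent_graph par n)\<^esub> 0" if "j < n" for j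
    using that
  proof (induction j rule: less_induct)
    case (less j)
    show ?case
    proof (cases "j = 0")
      case True
      then show ?thesis using less by auto
    next
      case False
      then have lt: "par j < j" using par less by simp
      then have "(j, par j) \<in> parcs (parent_graph par n)"
        using less.prems by (auto simp: parcs_parent_graph_iff)
      then show ?thesis
        using less.IH[OF lt] lt less.prems adj_reachable_trans by auto
    qed
  qed
  show ?thesis
    unfolding connected_def sym
  proof (rule strongly_connectedI)
    show "verts (with_proj (parent_graph par n)) \<noteq> {}" using assms(1) by auto
  next
    fix x y assume "x \<in> verts (with_proj (parent_graph par n))"
      "y \<in> verts (with_proj (parent_graph par n))"
    then have "x \<rightarrow>\<^sup>*\<^bsub>with_proj (parent_graph par n)\<^esub> 0"
      "0 \<rightarrow>\<^sup>*\<^bsub>with_proj (parent_graph par n)\<^esub> y"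
      using root symmetric_reachable' by auto
    then show "x \<rightarrow>\<^sup>*\<^bsub>with_proj (parent_graph par n)\<^esub> y" by (rule reachable_trans)
  qed
qed

lemma undirected_tree_parent_graph:
  assumes "n > 0" "\<And>j. 0 < j \<Longrightarrow> j < n \<Longrightarrow> par j < j"
  shows "undirected_tree (with_proj (parent_graph par n))"
  using parent_graph_no_long_cycle connected_parent_graph[OF assms]
    pair_graph.pair_graphD_graph[OF pair_graph_parent_graph]
  unfolding undirected_tree_def by (metis not_le)

section \<open>Isolating sets meet the neighbourhood of every path\<close>

text \<open>
  A path is a subgraph that is not necessarily induced, so an injective sequence of vertices with
  consecutive terms adjacent is enough.
\<close>

lemma contains_pathI:
  assumes wf: "wf_digraph (with_proj G)"
    and inj: "inj_on f {..<k}"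
    and vert: "\<And>i. i < k \<Longrightarrow> f i \<in> X"
    and adj: "\<And>i. Suc i < k \<Longrightarrow> (f i, f (Suc i)) \<in> parcs G \<and> (f (Suc i), f i) \<in> parcs G"
  shows "contains_path k (with_proj G \<restriction> X)"
proof -
  interpret P: pair_graph "path_graph k" by (rule pair_graph_path_graph)
  let ?h = "\<lparr>iso_verts = f, iso_arcs = map_prod f f, iso_head = snd, iso_tail = fst\<rparr>"
  let ?H = "app_iso ?h (with_proj (path_graph k))"
  have iso: "pre_digraph.digraph_isomorphism (with_proj (path_graph k)) ?h"
    using P.wf_digraph inj
    by (auto simp: pre_digraph.digraph_isomorphism_def path_graph_def inj_on_def)
  have "wf_digraph ?H"
    using P.wf_digraphI_app_iso[OF iso] .
  moreover have "wf_digraph (with_proj G \<restriction> X)"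
    using wf_digraph.wellformed_induce_subgraph[OF wf] .
  moreover have "verts ?H \<subseteq> X"
    using vert by (auto simp: path_graph_def)
  moreover have "arcs ?H \<subseteq> arcs (with_proj G \<restriction> X)"
    using vert adj by (auto simp: path_graph_def)
  ultimately have "subgraph ?H (with_proj G \<restriction> X)"
    by (simp add: subgraph_def compatible_def)
  then show ?thesis
    using iso by (auto simp: contains_path_def digraph_iso_def)
qed

lemma path_isolating_meets_path:
  assumes "pair_graph G"
    and iso: "path_isolating k (with_proj G) S"
    and inj: "inj_on f {..<k}"
    and vert: "\<And>i. i < k \<Longrightarrow> f i \<in> pverts G"
    and adj: "\<And>i. Suc i < k \<Longrightarrow> (f i, f (Suc i)) \<in> parcs G"
  shows "\<exists>i<k. \<exists>s\<in>S. f i = s \<or> (s, f i) \<in> parcs G"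
proof (rule ccontr)
  assume avoid: "\<not> ?thesis"
  interpret pair_graph G by fact
  have "contains_path k (with_proj G \<restriction> (pverts G - closed_nbhd (with_proj G) S))"
  proof (rule contains_pathI[OF wf_digraph inj])
    show "f i \<in> pverts G - closed_nbhd (with_proj G) S" if "i < k" for i
      using that vert avoid by (auto simp: closed_nbhd_def)
    show "(f i, f (Suc i)) \<in> parcs G \<and> (f (Suc i), f i) \<in> parcs G" if "Suc i < k" for i
      using adj[OF that] arcs_symmetric by blast
  qed
  then show False
    using iso by (simp add: path_isolating_def)
qed

section \<open>Counting disjoint sets by weight\<close>

text \<open>
  Linear programming duality in its easy direction, for the vertex weight that is the sum of the
  indicator functions of \<open>A\<close> and \<open>B\<close>: the members of the family have weight at least \<open>w\<close> each, and
  their weights add up to at most the total weight.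
\<close>

lemma card_disjoint_family_le_weight:
  fixes F :: "'a set set"
  assumes fin: "finite F" "finite A" "finite B"
    and disj: "pairwise disjnt F"
    and weight: "\<And>S. S \<in> F \<Longrightarrow> w \<le> card (S \<inter> A) + card (S \<inter> B)"
  shows "w * card F \<le> card A + card B"
proof -
  have trace: "(\<Sum>S\<in>F. card (S \<inter> C)) \<le> card C" if "finite C" for C
  proof -
    have "(\<Sum>S\<in>F. card (S \<inter> C)) = card (\<Union>S\<in>F. S \<inter> C)"
      using fin(1) that disj
      by (intro card_UN_disjoint[symmetric]) (auto simp: pairwise_def disjnt_def)
    also have "\<dots> \<le> card C"
      using that by (intro card_mono) auto
    finally show ?thesis .
  qed
  have "w * card F = (\<Sum>S\<in>F. w)" by simp
  also have "\<dots> \<le> (\<Sum>S\<in>F. card (S \<inter> A) + card (S \<inter> B))"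
    using weight by (rule sum_mono)
  also have "\<dots> \<le> card A + card B"
    using trace[OF fin(2)] trace[OF fin(3)] by (simp add: sum.distrib)
  finally show ?thesis .
qed

section \<open>A spider with one long leg\<close>

text \<open>
  The vertices \<open>0, \<dots>, b - 1\<close> are the leg of length \<open>b\<close> with its leaf at 0, the centre is \<open>b\<close>, the
  vertices \<open>b + 1, \<dots>, b + a\<close> are the leg of length \<open>a\<close>, and all vertices from \<open>b + a + 1\<close> on are
  the long leg. Consecutive numbers are thus adjacent, except that the long leg starts anew at
  the centre.
\<close>

definition spider_parent :: "nat \<Rightarrow> nat \<Rightarrow> nat \<Rightarrow> nat" where
  "spider_parent a b j = (if j = b + a + 1 then b else j - 1)"

abbreviation spider :: "nat \<Rightarrow> nat \<Rightarrow> nat \<Rightarrow> nat pair_pre_digraph" where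
  "spider a b n \<equiv> parent_graph (spider_parent a b) n"

lemma spider_adjacent_iff:
  "(i, j) \<in> parcs (spider a b n) \<longleftrightarrow>
     i < n \<and> j < n \<and>
     (if j = b + a + 1 then i = b \<or> i = j + 1
      else if i = b + a + 1 then j = b \<or> j = i + 1
      else j = i + 1 \<or> i = j + 1)"
  by (auto simp: parcs_parent_graph_iff spider_parent_def split: if_splits)

text \<open>
  The second set consists of the centre and its neighbours, whose vertices count twice. A single
  vertex \<open>s\<close> of the first set outside the second one misses the path that avoids the leg of \<open>s\<close>,
  and vertices beyond \<open>b + 2 * a + 1\<close> are too far away to help.
\<close>

lemma spider_isolating_weight:
  assumes n: "b + 2 * a < n"
    and long: "a + b + 1 = k" "b \<le> a"
    and iso: "path_isolating k (with_proj (spider a b n)) S"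
  shows "2 \<le> card (S \<inter> {..b + 2 * a + 1}) + card (S \<inter> {b - 1, b, b + 1, b + a + 1})"
proof -
  let ?A = "{..b + 2 * a + 1}" and ?B = "{b - 1, b, b + 1, b + a + 1}"
  let ?E = "parcs (spider a b n)"
  have meets: "\<exists>i<k. \<exists>s\<in>S. f i = s \<or> (s, f i) \<in> ?E"
    if "inj_on f {..<k}" "\<And>i. i < k \<Longrightarrow> f i < n" "\<And>i. Suc i < k \<Longrightarrow> (f i, f (Suc i)) \<in> ?E"
    for f
    using path_isolating_meets_path[OF pair_graph_parent_graph iso that(1) _ that(3)] that(2)
    by simp
  have short_and_a_leg_met: "\<exists>s\<in>S. \<exists>x\<le>b + a. x = s \<or> (s, x) \<in> ?E"
  proof -
    have "\<exists>i<k. \<exists>s\<in>S. i = s \<or> (s, i) \<in> ?E"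
      by (rule meets[of "\<lambda>i. i"]) (use n long in \<open>auto simp: spider_adjacent_iff\<close>)
    then show ?thesis using long by (metis less_Suc_eq_le add.commute Suc_eq_plus1)
  qed
  have short_and_long_leg_met:
    "\<exists>s\<in>S. \<exists>x. (x \<le> b \<or> b + a < x \<and> x \<le> b + 2 * a) \<and> (x = s \<or> (s, x) \<in> ?E)"
  proof -
    \<comment> \<open>The jump by \<open>a\<close> after the centre skips the leg of length \<open>a\<close>.\<close>
    let ?f = "\<lambda>i. if i \<le> b then i else a + i"
    have "\<exists>i<k. \<exists>s\<in>S. ?f i = s \<or> (s, ?f i) \<in> ?E"
      by (rule meets) (use n long in \<open>auto simp: spider_adjacent_iff inj_on_def\<close>)
    then obtain i s where "i < k" "s \<in> S" "?f i = s \<or> (s, ?f i) \<in> ?E" by blast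
    moreover have "?f i \<le> b \<or> b + a < ?f i \<and> ?f i \<le> b + 2 * a"
      using \<open>i < k\<close> long by auto
    ultimately show ?thesis by blast
  qed
  have a_and_long_leg_met: "\<exists>s\<in>S. \<exists>x. b \<le> x \<and> x \<le> b + 2 * a \<and> (x = s \<or> (s, x) \<in> ?E)"
  proof -
    \<comment> \<open>Down the leg of length \<open>a\<close> to the centre \<open>b\<close>, reached at index \<open>a\<close>, then up the long leg;
      this path has \<open>2 * a + 1 \<ge> k\<close> vertices, of which the first \<open>k\<close> are taken.\<close>
    let ?f = "\<lambda>i. if i \<le> a then b + a - i else b + i"
    have "\<exists>i<k. \<exists>s\<in>S. ?f i = s \<or> (s, ?f i) \<in> ?E"
      by (rule meets) (use n long in \<open>auto simp: spider_adjacent_iff inj_on_def split: if_splits\<close>)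
    then obtain i s where "i < k" "s \<in> S" "?f i = s \<or> (s, ?f i) \<in> ?E" by blast
    moreover have "b \<le> ?f i \<and> ?f i \<le> b + 2 * a"
      using \<open>i < k\<close> long by auto
    ultimately show ?thesis by blast
  qed
  show ?thesis
  proof (cases "S \<inter> ?B = {}")
    case False
    then obtain s where s: "s \<in> S \<inter> ?B" by blast
    then have "s \<in> S \<inter> ?A" by auto
    with s have "card (S \<inter> ?A) > 0" "card (S \<inter> ?B) > 0"
      unfolding card_gt_0_iff by blast+
    then show ?thesis by linarith
  next
    case weak: True
    have "\<not> card (S \<inter> ?A) \<le> 1"
    proof
      assume "card (S \<inter> ?A) \<le> 1"
      \<comment> \<open>If the intersection is empty, any \<open>s\<close> will do.\<close>
      then obtain s where only: "S \<inter> ?A \<subseteq> {s}"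
        by (cases "S \<inter> ?A = {}") (auto simp: card_le_Suc0_iff_eq)
      have low: "t = s" if "t \<in> S" "t \<le> b + 2 * a + 1" for t
        using only that by auto
      have notB: "t \<noteq> b - 1" "t \<noteq> b" "t \<noteq> b + 1" "t \<noteq> b + a + 1" if "t \<in> S" for t
        using weak that by auto
      consider "s < b" | "b < s \<and> s \<le> b + a" | "b + a < s" | "s = b" by linarith
      then show False
      proof cases
        case 1
        obtain t x where t: "t \<in> S" "b \<le> x" "x \<le> b + 2 * a" "x = t \<or> (t, x) \<in> ?E"
          using a_and_long_leg_met by blast
        show False using 1 t low[OF t(1)] notB[OF t(1)]
          by (auto simp: spider_adjacent_iff split: if_splits)
      next
        case 2
        obtain t x where t: "t \<in> S" "x \<le> b \<or> b + a < x \<and> x \<le> b + 2 * a"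
          "x = t \<or> (t, x) \<in> ?E"
          using short_and_long_leg_met by blast
        show False using 2 t low[OF t(1)] notB[OF t(1)]
          by (auto simp: spider_adjacent_iff split: if_splits)
      next
        case 3
        obtain t x where t: "t \<in> S" "x \<le> b + a" "x = t \<or> (t, x) \<in> ?E"
          using short_and_a_leg_met by blast
        show False using 3 t low[OF t(1)] notB[OF t(1)]
          by (auto simp: spider_adjacent_iff split: if_splits)
      next
        case 4
        \<comment> \<open>As \<open>b\<close> is not in \<open>S\<close>, here every vertex of \<open>S\<close> lies beyond \<open>b + 2 * a + 1\<close>.\<close>
        obtain t x where t: "t \<in> S" "x \<le> b + a" "x = t \<or> (t, x) \<in> ?E"
          using short_and_a_leg_met by blast
        show False using 4 t low[OF t(1)] notB[OF t(1)]
          by (auto simp: spider_adjacent_iff split: if_splits)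
      qed
    qed
    then show ?thesis by simp
  qed
qed

lemma max_disjoint_isolating_spider_le:
  assumes n: "b + 2 * a < n" and long: "a + b + 1 = k" "b \<le> a"
  shows "2 * max_disjoint_isolating k (with_proj (spider a b n)) \<le> k + a + 5"
proof -
  let ?T = "with_proj (spider a b n)"
  have fin: "finite (disjoint_isolating_families k ?T)"
    by (rule finite_disjoint_isolating_families) simp
  have bound: "2 * card F \<le> k + a + 5" if F: "F \<in> disjoint_isolating_families k ?T" for F
  proof -
    have iso: "path_isolating k ?T S" if "S \<in> F" for S
      using F that by (simp add: disjoint_isolating_families_def)
    have "F \<subseteq> Pow {..<n}"
      using iso by (auto simp: path_isolating_def)
    then have "finite F" by (rule finite_subset) simp
    then have "2 * card F \<le> card {..b + 2 * a + 1} + card {b - 1, b, b + 1, b + a + 1}"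
      using F spider_isolating_weight[OF n long iso]
      by (intro card_disjoint_family_le_weight) (auto simp: disjoint_isolating_families_def)
    also have "card {b - 1, b, b + 1, b + a + 1} \<le> 4"
      by (simp add: card_insert_if)
    finally show ?thesis using long by simp
  qed
  have "Max (card ` disjoint_isolating_families k ?T) \<in> card ` disjoint_isolating_families k ?T"
    using fin empty_in_disjoint_isolating_families by (intro Max_in) auto
  then show ?thesis
    using bound unfolding max_disjoint_isolating_def by auto
qed

theorem lemma8:
  fixes k :: nat
  assumes "k \<ge> 7"
  shows "(\<forall>n. \<exists>T :: nat pair_pre_digraph.
            undirected_tree (with_proj T) \<and> card (pverts T) \<ge> n \<and>
            real (max_disjoint_isolating k (with_proj T)) \<le> (3 * real k + 10) / 4) \<and>
         (3 * real k + 10) / 4 < real k + 1"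
proof (intro conjI allI)
  fix n :: nat
  \<comment> \<open>The least \<open>a\<close> for which \<open>b = k - 1 - a \<le> a\<close>; this minimises the bound \<open>k + a + 5\<close>.\<close>
  define a where "a = k div 2"
  define b where "b = k - 1 - a"
  define N where "N = n + b + 2 * a + 1"
  have long: "a + b + 1 = k" "b \<le> a" "2 * a \<le> k"
    using assms by (auto simp: a_def b_def)
  have "undirected_tree (with_proj (spider a b N))"
    by (rule undirected_tree_parent_graph) (auto simp: N_def spider_parent_def)
  moreover have "card (pverts (spider a b N)) \<ge> n"
    by (simp add: N_def)
  moreover have "4 * max_disjoint_isolating k (with_proj (spider a b N)) \<le> 3 * k + 10"
    (is "4 * ?m \<le> _")
    using max_disjoint_isolating_spider_le[of b a N k] long by (simp add: N_def)
  then have "real (4 * ?m) \<le> real (3 * k + 10)"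
    by (rule of_nat_mono)
  then have "real ?m \<le> (3 * real k + 10) / 4"
    by simp
  ultimately show "\<exists>T :: nat pair_pre_digraph.
      undirected_tree (with_proj T) \<and> card (pverts T) \<ge> n \<and>
      real (max_disjoint_isolating k (with_proj T)) \<le> (3 * real k + 10) / 4"
    by blast
next
  show "(3 * real k + 10) / 4 < real k + 1"
    using assms by simp
qed

end
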